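(* Let $\mathbf{S}$ be a completely simple semigroup. Then: (a) $\mathbf{S}$ is nilpotent if and only if its maximal subgroup is a nilpotent group; (b) $\mathbf{S}$ is solvable if and only if its maximal subgroup is a solvable group.
   Context: A completely simple semigroup is a simple semigroup (no proper ideals) containing a primitive idempotent, i.e. an element $e$ such that $x=e$ is the unique solution of $ex=xe=x=x^2$. The maximal subgroups of a completely simple semigroup are its $\mathcal{H}$-classes and are all isomorphic to one another, so "its maximal subgroup" is well defined up to isomorphism. Commutators. $\mathbb{N}=\{1,2,\dots\}$. For an algebra $\mathbf{A}$ and congruences $\alpha,\beta,\delta$ of $\mathbf{A}$, $C(\alpha,\beta;\delta)$ means: for all $n\in\mathbb{N}$, all $(n+1)$-ary term functions $t$ of $\mathbf{A}$, all $a,b\in A$ and $\mathbf{c},\mathbf{d}\in A^n$ with $a\,\alpha\,b$ and $c_i\,\beta\,d_i$ for every $i$, $t(a,\mathbf{c})\,\delta\,t(a,\mathbf{d})$ implies $t(b,\mathbf{c})\,\delta\,t(b,\mathbf{d})$. The commutator $[\alpha,\beta]$ is the least congruence $\delta$ with $C(\alpha,\beta;\delta)$. Semigroups are algebras with one binary operation; groups are algebras $(G,\cdot,{}^{-1},e)$. $0_A$ is the equality relation and $1_A$ the full relation on $A$. Nilpotency and solvability. Put $(\alpha,\beta]^{(1)}=[\alpha,\beta]$, $(\alpha,\beta]^{(k)}=[\alpha,(\alpha,\beta]^{(k-1)}]$ for $k\ge2$, and $[\alpha]^{(1)}=[\alpha,\alpha]$, $[\alpha]^{(k)}=[[\alpha]^{(k-1)},[\alpha]^{(k-1)}]$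 for $k\ge2$. An algebra $\mathbf{A}$ (semigroup or group) is $n$-nilpotent if $(1_A,1_A]^{(n)}=0_A$ and $n$-solvable if $[1_A]^{(n)}=0_A$; it is nilpotent (solvable) if it is $n$-nilpotent ($n$-solvable) for some $n\in\mathbb{N}$. For groups these are the usual notions. *)

theory Defs
  imports "HOL-Algebra.Group"
begin

section \<open>Algebras, term functions and congruences\<close>

text \<open>An algebra is a universe with a set of basic operations, each paired with its arity and
  taking its arguments as a list; values on lists of the wrong length, or with entries outside
  the universe, are irrelevant.\<close>

record 'a alg =
  univ :: "'a set"
  opers :: "(nat \<times> ('a list \<Rightarrow> 'a)) set"

definition closed_alg :: "'a alg \<Rightarrow> bool" where
  "closed_alg A \<longleftrightarrow>
     (\<forall>(k, f) \<in> opers A. \<forall>xs. length xs = k \<and> set xs \<subseteq> univ A \<longrightarrow> f xs \<in> univ A)"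

inductive term_fun :: "'a alg \<Rightarrow> nat \<Rightarrow> ('a list \<Rightarrow> 'a) \<Rightarrow> bool" for A n where
  proj: "i < n \<Longrightarrow> term_fun A n (\<lambda>xs. xs ! i)"
| comp: "(k, f) \<in> opers A \<Longrightarrow> length ts = k \<Longrightarrow> (\<forall>t \<in> set ts. term_fun A n t) \<Longrightarrow>
           term_fun A n (\<lambda>xs. f (map (\<lambda>t. t xs) ts))"

definition congruence :: "'a alg \<Rightarrow> ('a \<times> 'a) set \<Rightarrow> bool" where
  "congruence A \<theta> \<longleftrightarrow>
     equiv (univ A) \<theta> \<and>
     (\<forall>(k, f) \<in> opers A. \<forall>xs ys.
        length xs = k \<and> list_all2 (\<lambda>x y. (x, y) \<in> \<theta>) xs ys \<longrightarrow> (f xs, f ys) \<in> \<theta>)"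

section \<open>The term condition commutator\<close>

text \<open>\<open>centralizes A \<alpha> \<beta> \<delta>\<close> is $C(\alpha,\beta;\delta)$. The entries of the tuples lie in the
  universe because they are related by congruences.\<close>

definition centralizes ::
  "'a alg \<Rightarrow> ('a \<times> 'a) set \<Rightarrow> ('a \<times> 'a) set \<Rightarrow> ('a \<times> 'a) set \<Rightarrow> bool" where
  "centralizes A \<alpha> \<beta> \<delta> \<longleftrightarrow>
     (\<forall>n\<ge>1. \<forall>t a b cs ds.
        term_fun A (n + 1) t \<and> (a, b) \<in> \<alpha> \<and>
        length cs = n \<and> list_all2 (\<lambda>c d. (c, d) \<in> \<beta>) cs ds \<and>
        (t (a # cs), t (a # ds)) \<in> \<delta> \<longrightarrow> (t (b # cs), t (b # ds)) \<in> \<delta>)"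

definition commutator :: "'a alg \<Rightarrow> ('a \<times> 'a) set \<Rightarrow> ('a \<times> 'a) set \<Rightarrow> ('a \<times> 'a) set" where
  "commutator A \<alpha> \<beta> = (LEAST \<delta>. congruence A \<delta> \<and> centralizes A \<alpha> \<beta> \<delta>)"

text \<open>Starting the iterations at \<open>k = 0\<close> with \<open>\<beta>\<close> and \<open>\<alpha>\<close> gives $(\alpha,\beta]^{(k)}$ and
  $[\alpha]^{(k)}$ for all $k \ge 1$.\<close>

definition lower_series ::
  "'a alg \<Rightarrow> ('a \<times> 'a) set \<Rightarrow> ('a \<times> 'a) set \<Rightarrow> nat \<Rightarrow> ('a \<times> 'a) set" where
  "lower_series A \<alpha> \<beta> k = (commutator A \<alpha> ^^ k) \<beta>"

definition derived_series :: "'a alg \<Rightarrow> ('a \<times> 'a) set \<Rightarrow> nat \<Rightarrow> ('a \<times> 'a) set" where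
  "derived_series A \<alpha> k = ((\<lambda>\<theta>. commutator A \<theta> \<theta>) ^^ k) \<alpha>"

definition nilpotent_alg :: "'a alg \<Rightarrow> bool" where
  "nilpotent_alg A \<longleftrightarrow>
     (\<exists>n\<ge>1. lower_series A (univ A \<times> univ A) (univ A \<times> univ A) n = Id_on (univ A))"

definition solvable_alg :: "'a alg \<Rightarrow> bool" where
  "solvable_alg A \<longleftrightarrow> (\<exists>n\<ge>1. derived_series A (univ A \<times> univ A) n = Id_on (univ A))"

text \<open>The least congruence in the definition of the commutator exists.\<close>

lemma congruence_subset: "congruence A \<theta> \<Longrightarrow> \<theta> \<subseteq> univ A \<times> univ A"
  by (auto simp: congruence_def equiv_def)

lemma term_fun_closed:
  assumes "closed_alg A" "term_fun A n t" "length xs = n" "set xs \<subseteq> univ A"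
  shows "t xs \<in> univ A"
  using assms(2)
proof induction
  case (proj i)
  then show ?case using assms(3,4) nth_mem by blast
next
  case (comp k f ts)
  then have "set (map (\<lambda>t. t xs) ts) \<subseteq> univ A" by auto
  then show ?case using comp assms(1) unfolding closed_alg_def by fastforce
qed

lemma full_congruence:
  assumes "closed_alg A"
  shows "congruence A (univ A \<times> univ A)"
proof -
  have "f xs \<in> univ A \<and> f ys \<in> univ A"
    if f: "(k, f) \<in> opers A" and "length xs = k"
      and "list_all2 (\<lambda>x y. (x, y) \<in> univ A \<times> univ A) xs ys" for k f xs ys
  proof -
    have "length ys = k" "set xs \<subseteq> univ A" "set ys \<subseteq> univ A"
      using that by (auto simp: list_all2_conv_all_nth set_conv_nth)
    then show ?thesis using assms that unfolding closed_alg_def by fastforce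
  qed
  moreover have "equiv (univ A) (univ A \<times> univ A)"
    by (auto simp: equiv_def refl_on_def sym_def trans_def)
  ultimately show ?thesis unfolding congruence_def by fast
qed

lemma full_centralizes:
  assumes "closed_alg A" "congruence A \<alpha>" "congruence A \<beta>"
  shows "centralizes A \<alpha> \<beta> (univ A \<times> univ A)"
  unfolding centralizes_def
proof (intro allI impI, elim conjE)
  fix n t a b cs ds
  assume t: "term_fun A (n + 1) t" and ab: "(a, b) \<in> \<alpha>"
    and n: "length cs = n" and cd: "list_all2 (\<lambda>c d. (c, d) \<in> \<beta>) cs ds"
  have "b \<in> univ A" using ab congruence_subset[OF assms(2)] by auto
  moreover have "set cs \<subseteq> univ A" "set ds \<subseteq> univ A"
    using cd congruence_subset[OF assms(3)]
    by (auto simp: list_all2_conv_all_nth set_conv_nth)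
  moreover have "length ds = n" using cd n by (simp add: list_all2_lengthD)
  ultimately show "(t (b # cs), t (b # ds)) \<in> univ A \<times> univ A"
    using term_fun_closed[OF assms(1) t] n by simp
qed

lemma commutator_least:
  assumes "closed_alg A" "congruence A \<alpha>" "congruence A \<beta>"
  shows "congruence A (commutator A \<alpha> \<beta>)"
    and "centralizes A \<alpha> \<beta> (commutator A \<alpha> \<beta>)"
    and "\<And>\<delta>. congruence A \<delta> \<Longrightarrow> centralizes A \<alpha> \<beta> \<delta> \<Longrightarrow> commutator A \<alpha> \<beta> \<subseteq> \<delta>"
proof -
  define D where "D = {\<delta>. congruence A \<delta> \<and> centralizes A \<alpha> \<beta> \<delta>}"
  have ne: "univ A \<times> univ A \<in> D"
    unfolding D_def using full_congruence full_centralizes assms by blast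
  have eq: "equiv (univ A) (\<Inter>D)"
  proof -
    have "equiv (univ A) \<delta>" if "\<delta> \<in> D" for \<delta>
      using that by (simp add: D_def congruence_def)
    moreover have "\<Inter>D \<subseteq> univ A \<times> univ A" using ne by blast
    ultimately show ?thesis
      unfolding equiv_def refl_on_def sym_def trans_def by blast
  qed
  have "(f xs, f ys) \<in> \<Inter>D"
    if "(k, f) \<in> opers A" "length xs = k" "list_all2 (\<lambda>x y. (x, y) \<in> \<Inter>D) xs ys" for k f xs ys
  proof
    fix \<delta> assume d: "\<delta> \<in> D"
    then have "list_all2 (\<lambda>x y. (x, y) \<in> \<delta>) xs ys"
      using that(3) by (auto elim: list_all2_mono)
    then show "(f xs, f ys) \<in> \<delta>"
      using d that(1,2) unfolding D_def congruence_def by fast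
  qed
  then have con: "congruence A (\<Inter>D)" using eq unfolding congruence_def by fast
  have cen: "centralizes A \<alpha> \<beta> (\<Inter>D)"
    unfolding centralizes_def
  proof (intro allI impI, elim conjE, rule InterI)
    fix n t a b cs ds \<delta>
    assume "1 \<le> n" "term_fun A (n + 1) t" "(a, b) \<in> \<alpha>" "length cs = n"
      "list_all2 (\<lambda>c d. (c, d) \<in> \<beta>) cs ds" "(t (a # cs), t (a # ds)) \<in> \<Inter>D" and d: "\<delta> \<in> D"
    moreover have "centralizes A \<alpha> \<beta> \<delta>" using d by (simp add: D_def)
    ultimately show "(t (b # cs), t (b # ds)) \<in> \<delta>"
      unfolding centralizes_def by blast
  qed
  have "commutator A \<alpha> \<beta> = \<Inter>D"
    unfolding commutator_def
  proof (rule Least_equality)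
    show "congruence A (\<Inter>D) \<and> centralizes A \<alpha> \<beta> (\<Inter>D)" using con cen by simp
  qed (auto simp: D_def)
  then show "congruence A (commutator A \<alpha> \<beta>)" "centralizes A \<alpha> \<beta> (commutator A \<alpha> \<beta>)"
    "\<And>\<delta>. congruence A \<delta> \<Longrightarrow> centralizes A \<alpha> \<beta> \<delta> \<Longrightarrow> commutator A \<alpha> \<beta> \<subseteq> \<delta>"
    using con cen by (auto simp: D_def)
qed

section \<open>Semigroups and groups as algebras\<close>

definition semigroup_alg :: "('a \<Rightarrow> 'a \<Rightarrow> 'a) \<Rightarrow> 'a alg" where
  "semigroup_alg m = \<lparr>univ = UNIV, opers = {(2, \<lambda>xs. m (xs ! 0) (xs ! 1))}\<rparr>"

definition group_alg :: "'a monoid \<Rightarrow> 'a alg" where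
  "group_alg G = \<lparr>univ = carrier G,
     opers = {(2, \<lambda>xs. xs ! 0 \<otimes>\<^bsub>G\<^esub> xs ! 1), (1, \<lambda>xs. inv\<^bsub>G\<^esub> (xs ! 0)), (0, \<lambda>_. \<one>\<^bsub>G\<^esub>)}\<rparr>"

lemma closed_semigroup_alg: "closed_alg (semigroup_alg m)"
  by (simp add: closed_alg_def semigroup_alg_def)

lemma closed_group_alg: "group G \<Longrightarrow> closed_alg (group_alg G)"
  by (auto simp: closed_alg_def group_alg_def subset_iff intro!: monoid.m_closed group.is_monoid
      group.inv_closed monoid.one_closed)

section \<open>Completely simple semigroups\<close>

definition semigroup_ideal :: "('a \<Rightarrow> 'a \<Rightarrow> 'a) \<Rightarrow> 'a set \<Rightarrow> bool" where
  "semigroup_ideal m I \<longleftrightarrow> I \<noteq> {} \<and> (\<forall>s. \<forall>x \<in> I. m s x \<in> I \<and> m x s \<in> I)"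

definition simple_semigroup :: "('a \<Rightarrow> 'a \<Rightarrow> 'a) \<Rightarrow> bool" where
  "simple_semigroup m \<longleftrightarrow> semigroup m \<and> (\<forall>I. semigroup_ideal m I \<longrightarrow> I = UNIV)"

definition primitive_idempotent :: "('a \<Rightarrow> 'a \<Rightarrow> 'a) \<Rightarrow> 'a \<Rightarrow> bool" where
  "primitive_idempotent m e \<longleftrightarrow> (\<forall>x. m e x = x \<and> m x e = x \<and> m x x = x \<longleftrightarrow> x = e)"

definition completely_simple :: "('a \<Rightarrow> 'a \<Rightarrow> 'a) \<Rightarrow> bool" where
  "completely_simple m \<longleftrightarrow> simple_semigroup m \<and> (\<exists>e. primitive_idempotent m e)"

text \<open>A subgroup of a semigroup may have any idempotent as its identity element.\<close>

definition subgroup_of_semigroup :: "('a \<Rightarrow> 'a \<Rightarrow> 'a) \<Rightarrow> 'a monoid \<Rightarrow> bool" where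
  "subgroup_of_semigroup m G \<longleftrightarrow> group G \<and> mult G = m"

definition maximal_subgroup :: "('a \<Rightarrow> 'a \<Rightarrow> 'a) \<Rightarrow> 'a monoid \<Rightarrow> bool" where
  "maximal_subgroup m G \<longleftrightarrow>
     subgroup_of_semigroup m G \<and>
     (\<forall>K. subgroup_of_semigroup m K \<and> carrier G \<subseteq> carrier K \<longrightarrow> carrier K = carrier G)"

text \<open>Every idempotent \<open>e\<close> is the identity of a maximal subgroup, the group of units of
  $eSe$; in particular a completely simple semigroup has maximal subgroups.\<close>

lemma maximal_subgroup_exists:
  assumes "semigroup m" "m e e = e"
  shows "\<exists>G. maximal_subgroup m G \<and> \<one>\<^bsub>G\<^esub> = e"
proof -
  interpret semigroup m by fact
  define U where "U = {x. m e x = x \<and> m x e = x \<and>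
    (\<exists>y. m e y = y \<and> m y e = y \<and> m x y = e \<and> m y x = e)}"
  define G where "G = \<lparr>carrier = U, mult = m, one = e\<rparr>"
  have mem: "m x y \<in> U" if "x \<in> U" "y \<in> U" for x y
  proof -
    obtain x' y' where x': "m e x' = x'" "m x' e = x'" "m x x' = e" "m x' x = e"
      and y': "m e y' = y'" "m y' e = y'" "m y y' = e" "m y' y = e"
      using \<open>x \<in> U\<close> \<open>y \<in> U\<close> unfolding U_def by blast
    have e: "m e x = x" "m x e = x" "m e y = y" "m y e = y"
      using \<open>x \<in> U\<close> \<open>y \<in> U\<close> unfolding U_def by auto
    have "m (m x y) (m y' x') = e" "m (m y' x') (m x y) = e"
      by (metis assoc e x' y')+
    moreover have "m e (m x y) = m x y" "m (m x y) e = m x y"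
      "m e (m y' x') = m y' x'" "m (m y' x') e = m y' x'"
      by (metis assoc e x' y')+
    ultimately show ?thesis unfolding U_def by blast
  qed
  have "group G"
  proof (rule groupI)
    fix x assume "x \<in> carrier G"
    then show "\<exists>y\<in>carrier G. y \<otimes>\<^bsub>G\<^esub> x = \<one>\<^bsub>G\<^esub>"
      unfolding G_def U_def by auto
  qed (auto simp: G_def mem assoc, auto simp: U_def assms(2) intro!: exI[of _ e])
  moreover have "carrier K = carrier G"
    if "subgroup_of_semigroup m K" "carrier G \<subseteq> carrier K" for K
  proof -
    interpret K: group K using that(1) by (simp add: subgroup_of_semigroup_def)
    have [simp]: "x \<otimes>\<^bsub>K\<^esub> y = m x y" for x y
      using that(1) by (simp add: subgroup_of_semigroup_def)
    have "e \<in> carrier K" using that(2) assms(2) by (auto simp: G_def U_def)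
    then have e: "e = \<one>\<^bsub>K\<^esub>" using assms(2) K.r_cancel_one'[of e e] by simp
    have "x \<in> U" if "x \<in> carrier K" for x
      using K.l_one[OF that] K.r_one[OF that] K.inv_closed[OF that] K.l_inv[OF that]
        K.r_inv[OF that] K.l_one[OF K.inv_closed[OF that]] K.r_one[OF K.inv_closed[OF that]]
      unfolding U_def e by auto
    then show ?thesis using that(2) by (auto simp: G_def)
  qed
  ultimately show ?thesis
    by (intro exI[of _ G]) (auto simp: maximal_subgroup_def subgroup_of_semigroup_def G_def)
qed

end

theory Submission
  imports Defs
begin

text \<open>Let $e$ be the identity of the maximal subgroup $G$. In a completely simple semigroup $S$
  the group $G$ is all of $eSe$, and $x = x\,(exe)^{-1}\,x$ for every $x$
  (\<open>completely_simple_rees_coordinates\<close>). Hence each $x$ has Rees coordinates: the idempotents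
  $x(exe)^{-1}$ and $(exe)^{-1}x$ determine its $\mathcal{R}$-class and its $\mathcal{L}$-class,
  and the group coordinate is $exe \in G$. Products keep the first coordinate of the left factor and
  the second of the right factor, and multiply the group coordinates with a sandwich entry from $G$
  in between.

  In both algebras the commutator is controlled by ordinary commutation in $G$. Say that $\alpha$ and
  $\beta$ commute modulo $\delta$ if $xy \mathrel\delta yx$ for all $x, y \in G$ with
  $x \mathrel\alpha e$ and $y \mathrel\beta e$. The term condition $C(\alpha,\beta;\delta)$ implies this
  already for the semigroup term $y_1 x y_2$, because inverses may be used as parameters
  (\<open>commute_modulo_if_centralizes\<close>); so the group commutator is contained in the semigroup commutator
  and the series of $G$ lie below those of $S$.

  Conversely, let $\alpha$ and $\beta$ commute modulo $\delta$ on $G$. Then $C(\alpha,\beta;\delta)$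
  holds in $G$, and $C(\alpha',\beta';\hat\delta)$ holds in $S$, where $\hat\delta$ relates elements
  of one $\mathcal{H}$-class whose group coordinates are $\delta$-related, $\alpha'$ has group
  coordinates in $\alpha$ and $\beta' \subseteq \hat\beta$ (\<open>centralizes_lift\<close>). Moreover
  $[1_S,1_S]$ lies in $\mathcal{H}$, since $S/\mathcal{H}$ is a rectangular band, where either coordinate
  of a term depends on one variable only. By induction the $(k+1)$-st member of a series of $S$ lies
  in the lift of the $k$-th member for $G$. The lift of equality is equality, so if a series of $G$
  reaches equality, the one of $S$ does so at most one step later. The delay reflects the sandwich
  matrix: $[1_S,1_S]$ relates its entries to $e$, even when $G$ is abelian.\<close>

section \<open>Congruences and terms of semigroups and groups\<close>

lemma length_2_conv: "length xs = 2 \<longleftrightarrow> (\<exists>x y. xs = [x, y])"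
  by (auto simp: numeral_2_eq_2 length_Suc_conv)

lemma congruence_mult:
  assumes "congruence A \<theta>" "(2, \<lambda>xs. f (xs ! 0) (xs ! 1)) \<in> opers A"
    and "(x, y) \<in> \<theta>" "(z, w) \<in> \<theta>"
  shows "(f x z, f y w) \<in> \<theta>"
proof -
  have "\<forall>xs ys. length xs = 2 \<and> list_all2 (\<lambda>x y. (x, y) \<in> \<theta>) xs ys \<longrightarrow>
      (f (xs ! 0) (xs ! 1), f (ys ! 0) (ys ! 1)) \<in> \<theta>"
    using assms(1,2) unfolding congruence_def by fast
  from this[rule_format, of "[x, z]" "[y, w]"] show ?thesis
    using assms(3,4) by simp
qed

lemma term_fun_mult:
  assumes "(2, \<lambda>xs. f (xs ! 0) (xs ! 1)) \<in> opers A" "term_fun A n t" "term_fun A n u"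
  shows "term_fun A n (\<lambda>xs. f (t xs) (u xs))"
  using term_fun.comp[OF assms(1), of "[t, u]" n] assms(2,3) by simp

lemma mult_in_opers:
  "(2, \<lambda>xs. m (xs ! 0) (xs ! 1)) \<in> opers (semigroup_alg m)"
  "(2, \<lambda>xs. xs ! 0 \<otimes>\<^bsub>G\<^esub> xs ! 1) \<in> opers (group_alg G)"
  by (simp_all add: semigroup_alg_def group_alg_def)

lemma congruence_semigroup_algI:
  assumes "equiv UNIV \<theta>"
    and "\<And>x y z w. (x, y) \<in> \<theta> \<Longrightarrow> (z, w) \<in> \<theta> \<Longrightarrow> (m x z, m y w) \<in> \<theta>"
  shows "congruence (semigroup_alg m) \<theta>"
  using assms by (auto simp: congruence_def semigroup_alg_def length_2_conv list_all2_Cons1)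

lemma univ_algs [simp]: "univ (semigroup_alg m) = UNIV" "univ (group_alg G) = carrier G"
  by (simp_all add: semigroup_alg_def group_alg_def)

lemma Id_on_UNIV: "Id_on UNIV = Id"
  by auto

lemma term_fun_semigroup_induct [consumes 1, case_names proj mult]:
  assumes "term_fun (semigroup_alg m) n t"
    and "\<And>i. i < n \<Longrightarrow> P (\<lambda>xs. xs ! i)"
    and "\<And>t u. term_fun (semigroup_alg m) n t \<Longrightarrow> term_fun (semigroup_alg m) n u \<Longrightarrow>
      P t \<Longrightarrow> P u \<Longrightarrow> P (\<lambda>xs. m (t xs) (u xs))"
  shows "P t"
  using assms(1)
proof induction
  case (comp k f ts)
  then obtain t u where "ts = [t, u]" and f: "f = (\<lambda>xs. m (xs ! 0) (xs ! 1))"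
    by (auto simp: semigroup_alg_def length_2_conv)
  then show ?case using comp assms(3)[of t u] by simp
qed (rule assms(2))

lemma term_fun_group_induct [consumes 1, case_names proj mult inv one]:
  assumes "term_fun (group_alg G) n t"
    and "\<And>i. i < n \<Longrightarrow> P (\<lambda>xs. xs ! i)"
    and "\<And>t u. P t \<Longrightarrow> P u \<Longrightarrow> P (\<lambda>xs. t xs \<otimes>\<^bsub>G\<^esub> u xs)"
    and "\<And>t. P t \<Longrightarrow> P (\<lambda>xs. inv\<^bsub>G\<^esub> (t xs))"
    and "P (\<lambda>xs. \<one>\<^bsub>G\<^esub>)"
  shows "P t"
  using assms(1)
proof induction
  case (comp k f ts)
  consider (m) "k = 2" "f = (\<lambda>xs. xs ! 0 \<otimes>\<^bsub>G\<^esub> xs ! 1)" | (i) "k = 1" "f = (\<lambda>xs. inv\<^bsub>G\<^esub> (xs ! 0))"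
    | (o) "k = 0" "f = (\<lambda>_. \<one>\<^bsub>G\<^esub>)"
    using comp(1) by (auto simp: group_alg_def)
  then show ?case
  proof cases
    case m
    then obtain t u where "ts = [t, u]" using comp by (auto simp: length_2_conv)
    then show ?thesis using m comp assms(3)[of t u] by simp
  next
    case i
    then obtain t where "ts = [t]" using comp by (auto simp: length_Suc_conv)
    then show ?thesis using i comp assms(4)[of t] by simp
  next
    case o
    then show ?thesis using assms(5) by simp
  qed
qed (rule assms(2))

lemma term_fun_congruence:
  assumes "congruence A \<theta>" "term_fun A n t" "length xs = n"
    and "list_all2 (\<lambda>x y. (x, y) \<in> \<theta>) xs ys"
  shows "(t xs, t ys) \<in> \<theta>"
  using assms(2)
proof induction
  case (proj i)
  then show ?case using assms(3,4) by (simp add: list_all2_conv_all_nth)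
next
  case (comp k f ts)
  have "list_all2 (\<lambda>x y. (x, y) \<in> \<theta>) (map (\<lambda>t. t xs) ts) (map (\<lambda>t. t ys) ts)"
    using comp by (auto simp: list_all2_conv_all_nth)
  moreover have "length (map (\<lambda>t. t xs) ts) = k" using comp by simp
  ultimately show ?case using assms(1) comp(1) unfolding congruence_def by fast
qed

locale group_algebra = group G for G :: "'a monoid" (structure)
begin

lemma group_congruence_simps:
  assumes "congruence (group_alg G) \<theta>"
  shows "x \<in> carrier G \<Longrightarrow> (x, x) \<in> \<theta>"
    and "(x, y) \<in> \<theta> \<Longrightarrow> (y, x) \<in> \<theta>"
    and "(x, y) \<in> \<theta> \<Longrightarrow> (y, z) \<in> \<theta> \<Longrightarrow> (x, z) \<in> \<theta>"
    and "(x, y) \<in> \<theta> \<Longrightarrow> x \<in> carrier G"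
    and "(x, y) \<in> \<theta> \<Longrightarrow> y \<in> carrier G"
    and "(x, y) \<in> \<theta> \<Longrightarrow> (z, w) \<in> \<theta> \<Longrightarrow> (x \<otimes> z, y \<otimes> w) \<in> \<theta>"
proof -
  show "(x, y) \<in> \<theta> \<Longrightarrow> (z, w) \<in> \<theta> \<Longrightarrow> (x \<otimes> z, y \<otimes> w) \<in> \<theta>"
    by (rule congruence_mult[OF assms mult_in_opers(2)])
qed (use assms in \<open>auto simp: congruence_def equiv_def refl_on_def intro: symD transD\<close>)

text \<open>Cancelling $x$ and $y$ in $x^{-1} x y^{-1} \mathrel\theta x^{-1} y y^{-1}$ shows that inverses
  come for free, so a semigroup congruence restricts to a group congruence on a subgroup.\<close>

lemma equiv_mult_inv:
  assumes "equiv (carrier G) \<theta>"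
    and "\<And>x y z w. (x, y) \<in> \<theta> \<Longrightarrow> (z, w) \<in> \<theta> \<Longrightarrow> (x \<otimes> z, y \<otimes> w) \<in> \<theta>"
    and "(x, y) \<in> \<theta>"
  shows "(inv x, inv y) \<in> \<theta>"
proof -
  have xy: "x \<in> carrier G" "y \<in> carrier G"
    using assms(1,3) by (auto simp: equiv_def)
  have refl: "(z, z) \<in> \<theta>" if "z \<in> carrier G" for z
    using assms(1) that by (simp add: equiv_def refl_on_def)
  have "(inv x \<otimes> x \<otimes> inv y, inv x \<otimes> y \<otimes> inv y) \<in> \<theta>"
    by (intro assms(2) refl assms(3)) (use xy in simp_all)
  moreover have "inv x \<otimes> x \<otimes> inv y = inv y" "inv x \<otimes> y \<otimes> inv y = inv x"
    using xy by (simp_all add: m_assoc)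
  ultimately have "(inv y, inv x) \<in> \<theta>" by simp
  then show ?thesis using assms(1) by (auto simp: equiv_def intro: symD)
qed

lemma congruence_group_algI:
  assumes "equiv (carrier G) \<theta>"
    and "\<And>x y z w. (x, y) \<in> \<theta> \<Longrightarrow> (z, w) \<in> \<theta> \<Longrightarrow> (x \<otimes> z, y \<otimes> w) \<in> \<theta>"
  shows "congruence (group_alg G) \<theta>"
proof -
  have "(\<one>, \<one>) \<in> \<theta>" using assms(1) by (simp add: equiv_def refl_on_def)
  then show ?thesis
    using assms equiv_mult_inv[OF assms]
    by (auto simp: congruence_def group_alg_def length_2_conv length_Suc_conv list_all2_Cons1)
qed

lemma group_congruence_inv:
  assumes "congruence (group_alg G) \<theta>" "(x, y) \<in> \<theta>"
  shows "(inv x, inv y) \<in> \<theta>"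
  using equiv_mult_inv[OF _ group_congruence_simps(6)[OF assms(1)] assms(2)] assms(1)
  by (simp add: congruence_def)

section \<open>The commutator condition in a group\<close>

definition commute_modulo :: "('a \<times> 'a) set \<Rightarrow> ('a \<times> 'a) set \<Rightarrow> ('a \<times> 'a) set \<Rightarrow> bool" where
  "commute_modulo \<alpha> \<beta> \<delta> \<longleftrightarrow>
     (\<forall>x\<in>carrier G. \<forall>y\<in>carrier G. (x, \<one>) \<in> \<alpha> \<longrightarrow> (y, \<one>) \<in> \<beta> \<longrightarrow> (x \<otimes> y, y \<otimes> x) \<in> \<delta>)"

text \<open>For $t(x,y_1,y_2) = y_1 x y_2$ both sides of $t(e,y,y^{-1}) = t(e,e,e)$ are $e$, and the term
  condition turns this into $y x y^{-1} \mathrel\delta x$. Only multiplication occurs in $t$, so the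
  lemma serves both the group and a semigroup that contains it.\<close>

lemma commute_modulo_if_centralizes:
  assumes op: "(2, \<lambda>xs. xs ! 0 \<otimes> xs ! 1) \<in> opers A" and "carrier G \<subseteq> univ A"
    and "congruence A \<alpha>" "congruence A \<beta>" "congruence A \<delta>" "centralizes A \<alpha> \<beta> \<delta>"
  shows "commute_modulo \<alpha> \<beta> \<delta>"
  unfolding commute_modulo_def
proof (intro ballI impI)
  fix x y assume x: "x \<in> carrier G" and y: "y \<in> carrier G" and xa: "(x, \<one>) \<in> \<alpha>" and yb: "(y, \<one>) \<in> \<beta>"
  have refl: "(z, z) \<in> \<theta>" if "z \<in> carrier G" "congruence A \<theta>" for z \<theta>
    using that assms(2) by (auto simp: congruence_def equiv_def refl_on_def)
  have sym: "(v, u) \<in> \<theta>" if "(u, v) \<in> \<theta>" "congruence A \<theta>" for u v \<theta>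
    using that by (auto simp: congruence_def equiv_def intro: symD)
  define t where "t = (\<lambda>xs. xs ! 1 \<otimes> xs ! 0 \<otimes> xs ! 2)"
  have t: "term_fun A (2 + 1) t"
    unfolding t_def by (intro term_fun_mult[OF op] term_fun.proj) auto
  have "(inv y \<otimes> y, inv y \<otimes> \<one>) \<in> \<beta>"
    using congruence_mult[OF assms(4) op refl[OF inv_closed[OF y] assms(4)] yb] .
  then have "(\<one>, inv y) \<in> \<beta>" using y by simp
  then have "(inv y, \<one>) \<in> \<beta>" by (rule sym[OF _ assms(4)])
  then have cd: "list_all2 (\<lambda>c d. (c, d) \<in> \<beta>) [y, inv y] [\<one>, \<one>]" using yb by simp
  have "(t (\<one> # [y, inv y]), t (\<one> # [\<one>, \<one>])) \<in> \<delta>"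
    using y refl[OF _ assms(5)] by (simp add: t_def)
  then have "(t (x # [y, inv y]), t (x # [\<one>, \<one>])) \<in> \<delta>"
    using assms(6)[unfolded centralizes_def, rule_format, of 2 t \<one> x "[y, inv y]" "[\<one>, \<one>]"]
      t cd sym[OF xa assms(3)] by simp
  then have "(y \<otimes> x \<otimes> inv y, x) \<in> \<delta>" using x by (simp add: t_def)
  then have "(y \<otimes> x \<otimes> inv y \<otimes> y, x \<otimes> y) \<in> \<delta>"
    using congruence_mult[OF assms(5) op _ refl[OF y assms(5)]] by simp
  then show "(x \<otimes> y, y \<otimes> x) \<in> \<delta>"
    using x y sym[OF _ assms(5)] by (simp add: m_assoc)
qed

text \<open>The quadruples to which the term condition refers: \<open>u\<close>, \<open>u'\<close>, \<open>v\<close>, \<open>v'\<close> stand for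
  $t(a,\mathbf c)$, $t(a,\mathbf d)$, $t(b,\mathbf c)$, $t(b,\mathbf d)$. A bare implication
  $u \mathrel\delta u' \Rightarrow v \mathrel\delta v'$ would not survive an induction on $t$. Asking that
  the quotients $u^{-1}u'$ and $v^{-1}v'$ agree modulo $\delta$ gives, when $\alpha$ and $\beta$ commute
  modulo $\delta$, a subgroup of $G^4$.\<close>

definition parallel :: "('a \<times> 'a) set \<Rightarrow> ('a \<times> 'a) set \<Rightarrow> ('a \<times> 'a) set \<Rightarrow> 'a \<Rightarrow> 'a \<Rightarrow> 'a \<Rightarrow> 'a \<Rightarrow> bool"
  where "parallel \<alpha> \<beta> \<delta> u u' v v' \<longleftrightarrow>
    (u, v) \<in> \<alpha> \<and> (u, u') \<in> \<beta> \<and> (v, v') \<in> \<beta> \<and> (inv u \<otimes> u', inv v \<otimes> v') \<in> \<delta>"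

context
  fixes \<alpha> \<beta> \<delta>
  assumes cong: "congruence (group_alg G) \<alpha>" "congruence (group_alg G) \<beta>"
      "congruence (group_alg G) \<delta>"
    and comm: "commute_modulo \<alpha> \<beta> \<delta>"
begin

lemmas A = group_congruence_simps[OF cong(1)] group_congruence_inv[OF cong(1)]
lemmas B = group_congruence_simps[OF cong(2)] group_congruence_inv[OF cong(2)]
lemmas D = group_congruence_simps[OF cong(3)] group_congruence_inv[OF cong(3)]

text \<open>The quotient $v^{-1}u$ lies in the normal subgroup of $\alpha$ and so commutes with $k$ modulo
  $\delta$.\<close>

lemma conjugation_modulo:
  assumes uv: "(u, v) \<in> \<alpha>" and k: "(k, \<one>) \<in> \<beta>" and nk: "(n, k) \<in> \<delta>"
  shows "(u \<otimes> n \<otimes> inv u, v \<otimes> k \<otimes> inv v) \<in> \<delta>"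
proof -
  note c = A(4,5)[OF uv] B(4)[OF k] D(4)[OF nk]
  have "(inv v \<otimes> u, \<one>) \<in> \<alpha>" using A(6)[OF A(1) uv, of "inv v"] c by simp
  then have "(inv v \<otimes> u \<otimes> k, k \<otimes> (inv v \<otimes> u)) \<in> \<delta>"
    using comm k c unfolding commute_modulo_def by simp
  then have "(v \<otimes> (inv v \<otimes> u \<otimes> k) \<otimes> inv u, v \<otimes> (k \<otimes> (inv v \<otimes> u)) \<otimes> inv u) \<in> \<delta>"
    using c by (intro D(6)[OF D(6)] D(1)) simp_all
  moreover have "v \<otimes> (inv v \<otimes> u \<otimes> k) = u \<otimes> k" using c by (simp add: m_assoc[symmetric])
  moreover have "v \<otimes> (k \<otimes> (inv v \<otimes> u)) \<otimes> inv u = v \<otimes> k \<otimes> inv v" using c by (simp add: m_assoc)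
  ultimately have "(u \<otimes> k \<otimes> inv u, v \<otimes> k \<otimes> inv v) \<in> \<delta>" by simp
  moreover have "(u \<otimes> n \<otimes> inv u, u \<otimes> k \<otimes> inv u) \<in> \<delta>"
    using c nk by (intro D(6)[OF D(6)] D(1)) simp_all
  ultimately show ?thesis using D(3) by blast
qed

lemma quotient_modulo: "(u, v) \<in> \<beta> \<Longrightarrow> (inv u \<otimes> v, \<one>) \<in> \<beta>"
  using B(2)[OF B(6)[OF B(1), of "inv u" u v]] B(4)[of u v] by simp

text \<open>The quotient of a product is a conjugate of one quotient times the other:
  $(uw)^{-1}u'w' = w^{-1}(u^{-1}u')w \cdot w^{-1}w'$.\<close>

lemma parallel_mult:
  assumes u: "parallel \<alpha> \<beta> \<delta> u u' v v'" and w: "parallel \<alpha> \<beta> \<delta> w w' z z'"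
  shows "parallel \<alpha> \<beta> \<delta> (u \<otimes> w) (u' \<otimes> w') (v \<otimes> z) (v' \<otimes> z')"
proof -
  have c: "u \<in> carrier G" "u' \<in> carrier G" "v \<in> carrier G" "v' \<in> carrier G"
    "w \<in> carrier G" "w' \<in> carrier G" "z \<in> carrier G" "z' \<in> carrier G"
    using u w B(4,5) unfolding parallel_def by blast+
  have eq: "inv (a \<otimes> c) \<otimes> (a' \<otimes> c') = inv c \<otimes> (inv a \<otimes> a') \<otimes> inv (inv c) \<otimes> (inv c \<otimes> c')"
    if "a \<in> carrier G" "a' \<in> carrier G" "c \<in> carrier G" "c' \<in> carrier G" for a a' c c'
  proof -
    have "c \<otimes> (inv c \<otimes> c') = c'" using that by (simp add: m_assoc[symmetric])
    then show ?thesis using that by (simp add: inv_mult_group m_assoc)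
  qed
  have conj: "(inv w \<otimes> (inv u \<otimes> u') \<otimes> inv (inv w), inv z \<otimes> (inv v \<otimes> v') \<otimes> inv (inv z)) \<in> \<delta>"
    using u w by (intro conjugation_modulo A(7) quotient_modulo) (auto simp: parallel_def)
  have "(inv (u \<otimes> w) \<otimes> (u' \<otimes> w'), inv (v \<otimes> z) \<otimes> (v' \<otimes> z')) \<in> \<delta>"
    unfolding eq[OF c(1,2,5,6)] eq[OF c(3,4,7,8)] using w by (intro D(6)[OF conj]) (simp add: parallel_def)
  then show ?thesis using u w A(6) B(6) unfolding parallel_def by blast
qed

text \<open>The quotient of the inverses is again a conjugate: $u\,u'^{-1} = u\,(u^{-1}u')^{-1}u^{-1}$.\<close>

lemma parallel_inv:
  assumes u: "parallel \<alpha> \<beta> \<delta> u u' v v'"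
  shows "parallel \<alpha> \<beta> \<delta> (inv u) (inv u') (inv v) (inv v')"
proof -
  have c: "u \<in> carrier G" "u' \<in> carrier G" "v \<in> carrier G" "v' \<in> carrier G"
    using u B(4,5) unfolding parallel_def by blast+
  have eq: "inv (inv a) \<otimes> inv a' = a \<otimes> inv (inv a \<otimes> a') \<otimes> inv a"
    if "a \<in> carrier G" "a' \<in> carrier G" for a a'
    using that by (simp add: inv_mult_group m_assoc)
  have "(inv (inv v \<otimes> v'), inv \<one>) \<in> \<beta>"
    using u by (intro B(7) quotient_modulo) (auto simp: parallel_def)
  then have "(u \<otimes> inv (inv u \<otimes> u') \<otimes> inv u, v \<otimes> inv (inv v \<otimes> v') \<otimes> inv v) \<in> \<delta>"
    using u by (intro conjugation_modulo D(7)) (auto simp: parallel_def)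
  then show ?thesis using u A(7) B(7) unfolding parallel_def eq[OF c(1,2)] eq[OF c(3,4)] by blast
qed

lemma parallel_const: "(u, v) \<in> \<alpha> \<Longrightarrow> parallel \<alpha> \<beta> \<delta> u u v v"
  using A(4,5)[of u v] B(1) D(1)[OF one_closed] by (simp add: parallel_def)

lemma parallel_var: "(u, u') \<in> \<beta> \<Longrightarrow> parallel \<alpha> \<beta> \<delta> u u' u u'"
  using B(4,5)[of u u'] A(1) D(1) by (simp add: parallel_def)

lemma parallel_transfer:
  assumes "parallel \<alpha> \<beta> \<delta> u u' v v'" "(u, u') \<in> \<delta>"
  shows "(v, v') \<in> \<delta>"
proof -
  have c: "u \<in> carrier G" "u' \<in> carrier G" "v \<in> carrier G" "v' \<in> carrier G"
    using assms(1) B(4,5) unfolding parallel_def by blast+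
  have "(\<one>, inv u \<otimes> u') \<in> \<delta>" using D(6)[OF D(1) assms(2), of "inv u"] c by simp
  then have "(\<one>, inv v \<otimes> v') \<in> \<delta>" using assms(1) D(3) unfolding parallel_def by blast
  then show ?thesis using D(6)[OF D(1), of v \<one> "inv v \<otimes> v'"] c by (simp add: m_assoc[symmetric])
qed

lemma centralizes_if_commute_modulo: "centralizes (group_alg G) \<alpha> \<beta> \<delta>"
  unfolding centralizes_def
proof (intro allI impI, elim conjE)
  fix n t a b cs ds
  assume t: "term_fun (group_alg G) (n + 1) t" and ab: "(a, b) \<in> \<alpha>"
    and n: "length cs = n" and cd: "list_all2 (\<lambda>c d. (c, d) \<in> \<beta>) cs ds"
    and td: "(t (a # cs), t (a # ds)) \<in> \<delta>"
  have "parallel \<alpha> \<beta> \<delta> (t (a # cs)) (t (a # ds)) (t (b # cs)) (t (b # ds))"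
    using t
  proof (induction rule: term_fun_group_induct)
    case (proj i)
    then show ?case
      using parallel_const[OF ab] parallel_var n cd by (cases i) (auto simp: list_all2_conv_all_nth)
  qed (simp_all add: parallel_mult parallel_inv parallel_const A(1))
  then show "(t (b # cs), t (b # ds)) \<in> \<delta>" using td by (rule parallel_transfer)
qed

end

end

section \<open>Rees coordinates at a maximal subgroup\<close>

text \<open>The multiplication of \<open>G\<close> is a total operation on the type, so here it is the multiplication
  of the whole semigroup $S$, and the carrier is a subgroup of $S$. The last two assumptions say that
  $eSe \subseteq G$ and that every element is regular through $G$; they are all that is used of
  complete simplicity.\<close>

locale rees_coordinates = group_algebra +
  assumes assoc: "x \<otimes> y \<otimes> z = x \<otimes> (y \<otimes> z)"
    and local_closed: "\<one> \<otimes> x \<otimes> \<one> \<in> carrier G"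
    and regular: "x \<otimes> inv (\<one> \<otimes> x \<otimes> \<one>) \<otimes> x = x"
begin

text \<open>\<open>row x\<close> is the idempotent common to $R_x$ and $L_e$, and \<open>col x\<close> the one common to $R_e$ and
  $L_x$.\<close>

definition core :: "'a \<Rightarrow> 'a" where "core x = \<one> \<otimes> x \<otimes> \<one>"

definition row :: "'a \<Rightarrow> 'a" where "row x = x \<otimes> inv (core x)"

definition col :: "'a \<Rightarrow> 'a" where "col x = inv (core x) \<otimes> x"

lemma core_closed [simp]: "core x \<in> carrier G"
  using local_closed by (simp add: core_def)

lemma row_core_col: "row x \<otimes> core x \<otimes> col x = x"
proof -
  have "row x \<otimes> core x \<otimes> col x = x \<otimes> (inv (core x) \<otimes> core x \<otimes> inv (core x)) \<otimes> x"
    by (simp only: row_def col_def assoc)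
  also have "\<dots> = x" using regular[of x, folded core_def] by simp
  finally show ?thesis .
qed

lemma inv_core_absorb:
  "inv (core x) \<otimes> (\<one> \<otimes> y) = inv (core x) \<otimes> y" "y \<otimes> \<one> \<otimes> inv (core x) = y \<otimes> inv (core x)"
proof -
  show "inv (core x) \<otimes> (\<one> \<otimes> y) = inv (core x) \<otimes> y" by (simp flip: assoc)
  show "y \<otimes> \<one> \<otimes> inv (core x) = y \<otimes> inv (core x)" by (simp add: assoc)
qed

text \<open>\<open>col x \<otimes> row y\<close> is the entry of the sandwich matrix for the $\mathcal{L}$-class of \<open>x\<close> and the
  $\mathcal{R}$-class of \<open>y\<close>.\<close>

lemma col_row_closed: "col x \<otimes> row y \<in> carrier G"
proof -
  have "col x \<otimes> row y = inv (core x) \<otimes> (x \<otimes> y \<otimes> inv (core y))"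
    by (simp add: col_def row_def assoc)
  also have "\<dots> = inv (core x) \<otimes> (\<one> \<otimes> (x \<otimes> y \<otimes> \<one> \<otimes> inv (core y)))"
    by (simp only: inv_core_absorb)
  also have "\<dots> = inv (core x) \<otimes> core (x \<otimes> y) \<otimes> inv (core y)" by (simp only: core_def assoc)
  finally show ?thesis by simp
qed

lemma core_mult: "core (x \<otimes> y) = core x \<otimes> (col x \<otimes> row y) \<otimes> core y"
proof -
  have "core x \<otimes> (col x \<otimes> row y) \<otimes> core y =
      \<one> \<otimes> (x \<otimes> (\<one> \<otimes> inv (core x)) \<otimes> x) \<otimes> (y \<otimes> (inv (core y) \<otimes> \<one>) \<otimes> y) \<otimes> \<one>"
    by (simp only: core_def row_def col_def assoc)
  also have "\<dots> = core (x \<otimes> y)"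
    using regular[of x, folded core_def] regular[of y, folded core_def]
    by (simp add: core_def[of "x \<otimes> y"] assoc[of \<one>])
  finally show ?thesis by simp
qed

lemma row_mult: "row (x \<otimes> y) = row x"
proof -
  have "row (x \<otimes> y) = x \<otimes> inv (core x) \<otimes> x \<otimes> y \<otimes> inv (core (x \<otimes> y))"
    using regular[of x] by (simp add: row_def core_def)
  also have "\<dots> = x \<otimes> (inv (core x) \<otimes> (x \<otimes> y \<otimes> inv (core (x \<otimes> y))))"
    by (simp only: assoc)
  also have "\<dots> = x \<otimes> (inv (core x) \<otimes> (\<one> \<otimes> (x \<otimes> y \<otimes> \<one> \<otimes> inv (core (x \<otimes> y)))))"
    by (simp only: inv_core_absorb)
  also have "\<dots> = x \<otimes> (inv (core x) \<otimes> (core (x \<otimes> y) \<otimes> inv (core (x \<otimes> y))))"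
    by (simp only: core_def assoc)
  also have "\<dots> = row x" by (simp add: row_def)
  finally show ?thesis .
qed

lemma col_mult: "col (x \<otimes> y) = col y"
proof -
  have "col (x \<otimes> y) = inv (core (x \<otimes> y)) \<otimes> (x \<otimes> (y \<otimes> inv (core y) \<otimes> y))"
    using regular[of y] by (simp add: col_def core_def)
  also have "\<dots> = inv (core (x \<otimes> y)) \<otimes> (x \<otimes> y \<otimes> inv (core y)) \<otimes> y"
    by (simp only: assoc)
  also have "\<dots> = inv (core (x \<otimes> y)) \<otimes> (\<one> \<otimes> (x \<otimes> y \<otimes> \<one> \<otimes> inv (core y))) \<otimes> y"
    by (simp only: inv_core_absorb)
  also have "\<dots> = inv (core (x \<otimes> y)) \<otimes> core (x \<otimes> y) \<otimes> (inv (core y) \<otimes> y)"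
    by (simp only: core_def assoc)
  also have "\<dots> = col y" by (simp add: col_def flip: assoc)
  finally show ?thesis .
qed

section \<open>Commutators of the semigroup and of the group\<close>

abbreviation S :: "'a alg" where "S \<equiv> semigroup_alg (mult G)"

abbreviation H :: "'a alg" where "H \<equiv> group_alg G"

text \<open>Every element of an $\mathcal{H}$-class is determined by its core, so on a single class the lift is
  a copy of \<open>\<eta>\<close>.\<close>

definition lift :: "('a \<times> 'a) set \<Rightarrow> ('a \<times> 'a) set" where
  "lift \<eta> = {(x, y). row x = row y \<and> col x = col y \<and> (core x, core y) \<in> \<eta>}"

lemma lift_congruence:
  assumes "congruence H \<eta>"
  shows "congruence S (lift \<eta>)"
proof (rule congruence_semigroup_algI)
  note E = group_congruence_simps[OF assms]
  show "equiv UNIV (lift \<eta>)"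
    unfolding equiv_def refl_on_def sym_def trans_def lift_def mem_Collect_eq case_prod_conv
    by (intro conjI) (simp_all add: E(1), metis E(2), metis E(3))
  fix x y z w assume xy: "(x, y) \<in> lift \<eta>" and zw: "(z, w) \<in> lift \<eta>"
  have "(core x \<otimes> (col x \<otimes> row z) \<otimes> core z, core y \<otimes> (col x \<otimes> row z) \<otimes> core w) \<in> \<eta>"
    using xy zw by (intro E(6)[OF E(6)] E(1) col_row_closed) (simp_all add: lift_def)
  then show "(x \<otimes> z, y \<otimes> w) \<in> lift \<eta>"
    using xy zw by (simp add: lift_def row_mult col_mult core_mult)
qed

lemma lift_equality: "lift (Id_on (carrier G)) = Id"
proof -
  have "x = y" if "row x = row y" "col x = col y" "core x = core y" for x y
  proof -
    have "x = row x \<otimes> core x \<otimes> col x" by (rule row_core_col[symmetric])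
    also have "\<dots> = row y \<otimes> core y \<otimes> col y" by (simp only: that)
    finally show ?thesis by (simp only: row_core_col)
  qed
  then show ?thesis by (auto simp: lift_def)
qed

text \<open>Follow the group coordinates of the four values of a term. A product inserts a sandwich entry,
  which is unchanged when $\mathbf c$ is replaced by $\mathbf d$, because $\beta'$ lies in
  $\mathcal{H}$, and moves within $\alpha$ when $a$ is replaced by $b$. Such a quadruple is parallel. The
  assumption on $\alpha'$ admits both the full relation, which moves between $\mathcal{H}$-classes,
  and congruences below a lift; the central series needs the former and the derived series the
  latter.\<close>

lemma centralizes_lift:
  assumes cong: "congruence H \<alpha>" "congruence H \<beta>" "congruence H \<delta>"
    and comm: "commute_modulo \<alpha> \<beta> \<delta>"
    and "congruence S \<alpha>'" and core: "\<And>x y. (x, y) \<in> \<alpha>' \<Longrightarrow> (core x, core y) \<in> \<alpha>"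
    and \<beta>': "\<beta>' \<subseteq> lift \<beta>"
  shows "centralizes S \<alpha>' \<beta>' (lift \<delta>)"
  unfolding centralizes_def
proof (intro allI impI, elim conjE)
  fix n t a b cs ds
  assume t: "term_fun S (n + 1) t" and ab: "(a, b) \<in> \<alpha>'"
    and n: "length cs = n" and cd': "list_all2 (\<lambda>c d. (c, d) \<in> \<beta>') cs ds"
    and td: "(t (a # cs), t (a # ds)) \<in> lift \<delta>"
  note par = parallel_mult[OF cong comm] parallel_const[OF cong comm] parallel_var[OF cong comm]
  note A = group_congruence_simps[OF cong(1)] group_congruence_inv[OF cong(1)]
  have cd: "list_all2 (\<lambda>c d. (c, d) \<in> lift \<beta>) cs ds"
    using cd' \<beta>' by (auto elim: list_all2_mono)
  have refl: "(x, x) \<in> \<alpha>'" "(x, x) \<in> lift \<beta>" for x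
    using \<open>congruence S \<alpha>'\<close> lift_congruence[OF cong(2)]
    by (auto simp: congruence_def equiv_def refl_on_def)
  have vary_head: "(u (a # cs), u (b # cs)) \<in> \<alpha>'" if "term_fun S (n + 1) u" for u
    using term_fun_congruence[OF \<open>congruence S \<alpha>'\<close> that] n ab refl(1)
    by (simp add: list_all2_refl)
  have vary_tail: "(u (x # cs), u (x # ds)) \<in> lift \<beta>" if "term_fun S (n + 1) u" for u x
    using term_fun_congruence[OF lift_congruence[OF cong(2)] that] n cd refl(2) by simp
  have link: "(col x \<otimes> row y, col x' \<otimes> row y') \<in> \<alpha>"
    if "(x, x') \<in> \<alpha>'" "(y, y') \<in> \<alpha>'" for x x' y y'
  proof -
    \<comment> \<open>A sandwich entry is a group expression in cores, and \<open>\<alpha>'\<close> is compatible with products.\<close>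
    have eq: "col u \<otimes> row v = inv (core u) \<otimes> core (u \<otimes> v) \<otimes> inv (core v)" for u v
    proof -
      have "(inv (core u) \<otimes> core u) \<otimes> (col u \<otimes> row v) \<otimes> (core v \<otimes> inv (core v)) =
          inv (core u) \<otimes> core (u \<otimes> v) \<otimes> inv (core v)"
        unfolding core_mult by (simp only: assoc)
      then show ?thesis by (simp add: col_row_closed)
    qed
    have "(core (x \<otimes> y), core (x' \<otimes> y')) \<in> \<alpha>"
      using congruence_mult[OF \<open>congruence S \<alpha>'\<close> mult_in_opers(1) that] by (rule core)
    then show ?thesis unfolding eq using core that by (intro A(6,7)) auto
  qed
  have "parallel \<alpha> \<beta> \<delta> (core (t (a # cs))) (core (t (a # ds))) (core (t (b # cs))) (core (t (b # ds)))"
    using t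
  proof (induction rule: term_fun_semigroup_induct)
    case (proj i)
    then show ?case
      using par(2)[OF core[OF ab]] par(3) n cd
      by (cases i) (auto simp: list_all2_conv_all_nth lift_def)
  next
    case (mult u v)
    have "col (u (x # ds)) = col (u (x # cs))" "row (v (x # ds)) = row (v (x # cs))" for x
      using vary_tail[OF mult(1)] vary_tail[OF mult(2)] by (auto simp: lift_def)
    then show ?case
      unfolding core_mult
      using par(1)[OF par(1)[OF mult(3) par(2)[OF link[OF vary_head vary_head]]] mult(4)] mult(1,2)
      by simp
  qed
  then have "(core (t (b # cs)), core (t (b # ds))) \<in> \<delta>"
    using parallel_transfer[OF cong comm] td by (simp add: lift_def)
  then show "(t (b # cs), t (b # ds)) \<in> lift \<delta>"
    using vary_tail[OF t] by (auto simp: lift_def)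
qed

lemma commutator_subset_lift:
  assumes "congruence H \<alpha>" "congruence H \<beta>" "congruence S \<alpha>'" "congruence S \<beta>'"
    and "\<And>x y. (x, y) \<in> \<alpha>' \<Longrightarrow> (core x, core y) \<in> \<alpha>" "\<beta>' \<subseteq> lift \<beta>"
  shows "commutator S \<alpha>' \<beta>' \<subseteq> lift (commutator H \<alpha> \<beta>)"
proof -
  note comm = commutator_least[OF closed_group_alg[OF is_group] assms(1,2)]
  have "commute_modulo \<alpha> \<beta> (commutator H \<alpha> \<beta>)"
    by (rule commute_modulo_if_centralizes[OF mult_in_opers(2) _ assms(1,2) comm(1,2)]) simp
  then show ?thesis
    using comm(1) assms
    by (intro commutator_least(3)[OF closed_semigroup_alg assms(3,4)] lift_congruence centralizes_lift)
qed

lemma commutator_group_subset: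
  assumes "congruence H \<alpha>" "congruence H \<beta>" "congruence S \<alpha>'" "congruence S \<beta>'"
    and "\<alpha> \<subseteq> \<alpha>'" "\<beta> \<subseteq> \<beta>'"
  shows "commutator H \<alpha> \<beta> \<subseteq> commutator S \<alpha>' \<beta>'"
proof -
  note comm = commutator_least[OF closed_semigroup_alg assms(3,4)]
  define \<delta> where "\<delta> = commutator S \<alpha>' \<beta>' \<inter> carrier G \<times> carrier G"
  have "congruence H \<delta>"
  proof (rule congruence_group_algI)
    show "equiv (carrier G) \<delta>"
    proof (rule equivI)
      have "equiv UNIV (commutator S \<alpha>' \<beta>')" using comm(1) by (simp add: congruence_def)
      then have "refl (commutator S \<alpha>' \<beta>')" "sym (commutator S \<alpha>' \<beta>')" "trans (commutator S \<alpha>' \<beta>')"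
        by (auto elim: equivE)
      then show "refl_on (carrier G) \<delta>" "sym \<delta>" "trans \<delta>" "\<delta> \<subseteq> carrier G \<times> carrier G"
        by (auto simp: \<delta>_def refl_on_def sym_def intro!: transI dest: transD)
    qed
    show "(x \<otimes> z, y \<otimes> w) \<in> \<delta>" if "(x, y) \<in> \<delta>" "(z, w) \<in> \<delta>" for x y z w
      using that congruence_mult[OF comm(1) mult_in_opers(1), of x y z w] by (simp add: \<delta>_def)
  qed
  moreover have "commute_modulo \<alpha>' \<beta>' (commutator S \<alpha>' \<beta>')"
    by (rule commute_modulo_if_centralizes[OF mult_in_opers(1) _ assms(3,4) comm(1,2)]) simp
  then have "commute_modulo \<alpha> \<beta> \<delta>"
    using assms(5,6) m_closed unfolding commute_modulo_def \<delta>_def by blast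
  ultimately have "commutator H \<alpha> \<beta> \<subseteq> \<delta>"
    using assms(1,2)
    by (intro commutator_least(3)[OF closed_group_alg[OF is_group]] centralizes_if_commute_modulo)
  then show ?thesis by (auto simp: \<delta>_def)
qed

text \<open>The $\mathcal{R}$-class of a value of a term is that of its leftmost variable, and the
  $\mathcal{L}$-class that of its rightmost.\<close>

lemma term_row: "term_fun S n t \<Longrightarrow> \<exists>j<n. \<forall>xs. row (t xs) = row (xs ! j)"
  by (induction rule: term_fun_semigroup_induct) (auto simp: row_mult)

lemma term_col: "term_fun S n t \<Longrightarrow> \<exists>j<n. \<forall>xs. col (t xs) = col (xs ! j)"
  by (induction rule: term_fun_semigroup_induct) (auto simp: col_mult)

lemma full_commutator_subset:
  "commutator S UNIV UNIV \<subseteq> lift (carrier G \<times> carrier G)"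
proof (rule commutator_least(3)[OF closed_semigroup_alg])
  show "congruence S UNIV" using full_congruence[OF closed_semigroup_alg] by simp
  then show "congruence S UNIV" .
  show "congruence S (lift (carrier G \<times> carrier G))"
    using full_congruence[OF closed_group_alg[OF is_group]] by (intro lift_congruence) simp
  \<comment> \<open>If the decisive variable is the first, both values equal \<open>g b\<close>; otherwise \<open>a\<close> and \<open>b\<close> do not
    enter at all.\<close>
  have transfer: "g (t (b # cs)) = g (t (b # ds))"
    if ex: "\<exists>j<n. \<forall>xs. g (t xs) = g (xs ! j)" "g (t (a # cs)) = g (t (a # ds))"
    for g :: "'a \<Rightarrow> 'a" and t n a b cs ds
  proof -
    obtain j where "\<forall>xs. g (t xs) = g (xs ! j)" using ex by blast
    then show ?thesis using that(2) by (cases j) auto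
  qed
  show "centralizes S UNIV UNIV (lift (carrier G \<times> carrier G))"
    unfolding centralizes_def
  proof (intro allI impI, elim conjE)
    fix n t a b cs ds
    assume t: "term_fun S (n + 1) t"
      and "(t (a # cs), t (a # ds)) \<in> lift (carrier G \<times> carrier G)"
    then show "(t (b # cs), t (b # ds)) \<in> lift (carrier G \<times> carrier G)"
      using transfer[OF term_row[OF t], of a cs ds b] transfer[OF term_col[OF t], of a cs ds b]
      by (simp add: lift_def)
  qed
qed

section \<open>The central and the derived series\<close>

lemma series_Suc:
  "lower_series A \<alpha> \<beta> (Suc k) = commutator A \<alpha> (lower_series A \<alpha> \<beta> k)"
  "derived_series A \<alpha> (Suc k) = commutator A (derived_series A \<alpha> k) (derived_series A \<alpha> k)"
  by (simp_all add: lower_series_def derived_series_def)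

lemma series_congruence:
  assumes "closed_alg A"
  shows "congruence A (lower_series A (univ A \<times> univ A) (univ A \<times> univ A) k)"
    and "congruence A (derived_series A (univ A \<times> univ A) k)"
proof (induction k)
  case 0
  { case 1 then show ?case using full_congruence[OF assms] by (simp add: lower_series_def)
  next
    case 2 then show ?case using full_congruence[OF assms] by (simp add: derived_series_def) }
next
  case (Suc k)
  { case 1 then show ?case
      using commutator_least(1)[OF assms full_congruence[OF assms] Suc(1)] by (simp add: series_Suc)
  next
    case 2 then show ?case
      using commutator_least(1)[OF assms Suc(2) Suc(2)] by (simp add: series_Suc) }
qed

abbreviation lower_S :: "nat \<Rightarrow> ('a \<times> 'a) set" where "lower_S \<equiv> lower_series S UNIV UNIV"
abbreviation lower_H :: "nat \<Rightarrow> ('a \<times> 'a) set" where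
  "lower_H \<equiv> lower_series H (carrier G \<times> carrier G) (carrier G \<times> carrier G)"
abbreviation derived_S :: "nat \<Rightarrow> ('a \<times> 'a) set" where "derived_S \<equiv> derived_series S UNIV"
abbreviation derived_H :: "nat \<Rightarrow> ('a \<times> 'a) set" where
  "derived_H \<equiv> derived_series H (carrier G \<times> carrier G)"

lemmas S_congruence =
  full_congruence[OF closed_semigroup_alg[of "mult G"], simplified]
  series_congruence[OF closed_semigroup_alg[of "mult G"], simplified]

lemmas H_congruence =
  full_congruence[OF closed_group_alg[OF is_group], simplified]
  series_congruence[OF closed_group_alg[OF is_group], simplified]

lemma lower_H_subset: "lower_H k \<subseteq> lower_S k"
proof (induction k)
  case (Suc k)
  show ?case
    unfolding series_Suc by (rule commutator_group_subset[OF H_congruence(1,2) S_congruence(1,2) _ Suc]) simp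
qed (simp add: lower_series_def)

lemma derived_H_subset: "derived_H k \<subseteq> derived_S k"
proof (induction k)
  case (Suc k)
  show ?case
    unfolding series_Suc
    by (rule commutator_group_subset[OF H_congruence(3,3) S_congruence(3,3) Suc Suc])
qed (simp add: derived_series_def)

text \<open>The index is shifted by one: the first commutator is spent on reaching $\mathcal{H}$, which is
  the lift of the full relation on the group.\<close>

lemma lower_S_subset: "lower_S (Suc k) \<subseteq> lift (lower_H k)"
proof (induction k)
  case 0
  show ?case using full_commutator_subset by (simp add: lower_series_def)
next
  case (Suc k)
  show ?case
    unfolding series_Suc(1)[of _ _ _ "Suc k"] series_Suc(1)[of H _ _ k]
    by (rule commutator_subset_lift[OF H_congruence(1,2) S_congruence(1,2) _ Suc]) simp
qed

lemma derived_S_subset: "derived_S (Suc k) \<subseteq> lift (derived_H k)"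
proof (induction k)
  case 0
  show ?case using full_commutator_subset by (simp add: derived_series_def)
next
  case (Suc k)
  have "(core x, core y) \<in> derived_H k" if "(x, y) \<in> derived_S (Suc k)" for x y
    using that Suc by (auto simp: lift_def)
  then show ?case
    unfolding series_Suc(2)[of _ _ "Suc k"] series_Suc(2)[of H _ k]
    by (rule commutator_subset_lift[OF H_congruence(3,3) S_congruence(3,3) _ Suc])
qed

lemma S_congruence_equality_if: "congruence S \<theta> \<Longrightarrow> \<theta> \<subseteq> lift (Id_on (carrier G)) \<Longrightarrow> \<theta> = Id"
  unfolding lift_equality by (auto simp: congruence_def equiv_def refl_on_def)

lemma H_congruence_equality_if: "congruence H \<theta> \<Longrightarrow> \<theta> \<subseteq> Id \<Longrightarrow> \<theta> = Id_on (carrier G)"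
  by (auto simp: congruence_def equiv_def refl_on_def Id_on_def)

lemma nilpotent_iff: "nilpotent_alg S \<longleftrightarrow> nilpotent_alg H"
proof
  assume "nilpotent_alg S"
  then obtain n where "n \<ge> 1" "lower_S n = Id" by (auto simp: nilpotent_alg_def Id_on_UNIV)
  then show "nilpotent_alg H"
    using H_congruence_equality_if[OF H_congruence(2), of n] lower_H_subset[of n]
    by (auto simp: nilpotent_alg_def Id_on_UNIV)
next
  assume "nilpotent_alg H"
  then obtain n where "lower_H n = Id_on (carrier G)" by (auto simp: nilpotent_alg_def Id_on_UNIV)
  then have "lower_S (Suc n) = Id"
    using S_congruence_equality_if[OF S_congruence(2)] lower_S_subset[of n] by metis
  then show "nilpotent_alg S" unfolding nilpotent_alg_def by (auto intro!: exI[of _ "Suc n"] simp: Id_on_UNIV)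
qed

lemma solvable_iff: "solvable_alg S \<longleftrightarrow> solvable_alg H"
proof
  assume "solvable_alg S"
  then obtain n where "n \<ge> 1" "derived_S n = Id" by (auto simp: solvable_alg_def Id_on_UNIV)
  then show "solvable_alg H"
    using H_congruence_equality_if[OF H_congruence(3), of n] derived_H_subset[of n]
    by (auto simp: solvable_alg_def Id_on_UNIV)
next
  assume "solvable_alg H"
  then obtain n where "derived_H n = Id_on (carrier G)" by (auto simp: solvable_alg_def Id_on_UNIV)
  then have "derived_S (Suc n) = Id"
    using S_congruence_equality_if[OF S_congruence(3)] derived_S_subset[of n] by metis
  then show "solvable_alg S" unfolding solvable_alg_def by (auto intro!: exI[of _ "Suc n"] simp: Id_on_UNIV)
qed

end

section \<open>Completely simple semigroups have Rees coordinates\<close>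

text \<open>The monoid $eSe = \{x.\; ex = x = xe\}$ is a group.\<close>

definition local_group :: "('a \<Rightarrow> 'a \<Rightarrow> 'a) \<Rightarrow> 'a \<Rightarrow> bool" where
  "local_group m e \<longleftrightarrow> m e e = e \<and>
     (\<forall>x. m e x = x \<longrightarrow> m x e = x \<longrightarrow> (\<exists>y. m e y = y \<and> m y e = y \<and> m x y = e \<and> m y x = e))"

text \<open>The set $SaS$ is an ideal.\<close>

lemma simple_semigroup_divides:
  assumes "simple_semigroup m"
  shows "\<exists>s t. m (m s a) t = b"
proof -
  interpret semigroup m using assms by (simp add: simple_semigroup_def)
  have "m r (m (m s a) t) = m (m (m r s) a) t" "m (m (m s a) t) r = m (m s a) (m t r)" for r s t
    by (simp_all only: assoc)
  then have "semigroup_ideal m {m (m s a) t | s t. True}"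
    unfolding semigroup_ideal_def by blast
  then have "{m (m s a) t | s t. True} = UNIV" using assms by (simp add: simple_semigroup_def)
  then have "b \<in> {m (m s a) t | s t. True}" by simp
  then show ?thesis by blast
qed

text \<open>For $x \in eSe$ simplicity gives $sxt = e$ with $s, t \in eSe$. Then $tsx$ and $xts$ are
  idempotents below $e$, so both equal $e$ and $ts$ is inverse to $x$.\<close>

lemma local_group_primitive:
  assumes "simple_semigroup m" "primitive_idempotent m e"
  shows "local_group m e"
  unfolding local_group_def
proof (intro conjI allI impI)
  interpret semigroup m using assms by (simp add: simple_semigroup_def)
  show ee: "m e e = e" using assms(2) unfolding primitive_idempotent_def by blast
  have prim: "f = e" if "m e f = f" "m f e = f" "m f f = f" for f
    using assms(2) that unfolding primitive_idempotent_def by blast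
  fix x assume ex: "m e x = x" and xe: "m x e = x"
  obtain s0 t0 where st0: "m (m s0 x) t0 = e" using simple_semigroup_divides[OF assms(1)] by blast
  define s t where "s = m (m e s0) e" and "t = m (m e t0) e"
  have st_e: "m e s = s" "m s e = s" "m e t = t" "m t e = t"
    using ee by (simp_all add: s_def t_def assoc) (simp_all flip: assoc)
  have "m (m s x) t = m e (m (m s0 (m (m e x) e)) (m t0 e))" by (simp only: s_def t_def assoc)
  also have "\<dots> = m e (m (m (m s0 x) t0) e)" by (simp only: ex xe assoc)
  also have "\<dots> = e" by (simp only: st0 ee)
  finally have sxt: "m (m s x) t = e" .
  define y where "y = m t s"
  have y: "m e y = y" "m y e = y" using st_e by (simp_all add: y_def assoc) (simp flip: assoc)
  have "m (m y x) (m y x) = m t (m (m (m s x) t) (m s x))" by (simp only: y_def assoc)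
  also have "\<dots> = m y x" using st_e by (simp add: sxt y_def flip: assoc)
  finally have yx: "m y x = e" using y xe by (intro prim) (simp_all add: assoc, simp flip: assoc)
  have "m (m x y) (m x y) = m x (m t (m (m (m s x) t) s))" by (simp only: y_def assoc)
  also have "\<dots> = m x y" using st_e by (simp add: sxt y_def)
  finally have "m x y = e" using y ex by (intro prim) (simp_all add: assoc, simp flip: assoc)
  then show "\<exists>y. m e y = y \<and> m y e = y \<and> m x y = e \<and> m y x = e" using y yx by blast
qed

text \<open>A maximal subgroup need not have the given primitive idempotent as its identity. Write
  $f = ab$ with $a \in fSe$ and $b \in eSf$. Then $ba$ is an idempotent of the group $eSe$, so
  $ba = e$, and $x \mapsto bxa$ is an isomorphism from $fSf$ to $eSe$ with inverse
  $g \mapsto agb$.\<close>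

lemma local_group_idempotent:
  assumes "simple_semigroup m" "local_group m e" "m f f = f"
  shows "local_group m f"
  unfolding local_group_def
proof (intro conjI allI impI)
  interpret semigroup m using assms by (simp add: simple_semigroup_def)
  show "m f f = f" by fact
  have ee: "m e e = e" using assms(2) by (simp add: local_group_def)
  have inverse: "\<exists>y. m e y = y \<and> m y e = y \<and> m x y = e \<and> m y x = e"
    if "m e x = x" "m x e = x" for x
    using assms(2) that by (simp add: local_group_def)
  obtain s t where st: "m (m s e) t = f" using simple_semigroup_divides[OF assms(1)] by blast
  define a b where "a = m (m f s) e" and "b = m e (m t f)"
  have ae: "m a e = a" and eb: "m e b = b" and fa: "m f a = a" and bf: "m b f = b"
    using ee assms(3) by (simp_all add: a_def b_def assoc) (simp_all flip: assoc)
  have "m a b = m f (m (m (m s (m e e)) t) f)" by (simp only: a_def b_def assoc)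
  then have ab: "m a b = f" using st ee assms(3) by simp
  define c where "c = m b a"
  have cc: "m c c = c" using ab fa by (simp add: c_def assoc) (simp flip: assoc)
  have ec: "m e c = c" "m c e = c" using ae eb by (simp_all add: c_def assoc) (simp flip: assoc)
  then obtain c' where "m c c' = e" using inverse by blast
  have "c = m (m c c) c'" using ec \<open>m c c' = e\<close> by (simp only: assoc)
  then have ba: "m b a = e" using cc \<open>m c c' = e\<close> by (simp add: c_def)
  fix x assume fx: "m f x = x" and xf: "m x f = x"
  define g where "g = m (m b x) a"
  have "m e g = g" "m g e = g" using ae eb by (simp_all add: g_def assoc) (simp flip: assoc)
  then obtain g' where g': "m e g' = g'" "m g' e = g'" "m g g' = e" "m g' g = e"
    using inverse by blast
  define y where "y = m (m a g') b"
  have "m f y = y" "m y f = y" using fa bf by (simp_all add: y_def assoc) (simp flip: assoc)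
  moreover have "m x y = f"
  proof -
    have "m x y = m (m (m a b) x) (m (m a g') b)" by (simp add: ab fx y_def)
    also have "\<dots> = m (m a (m g g')) b" by (simp only: g_def assoc)
    finally show ?thesis by (simp add: g' ae ab)
  qed
  moreover have "m y x = f"
  proof -
    have "m y x = m (m (m a g') b) (m x (m a b))" by (simp add: ab xf y_def)
    also have "\<dots> = m (m a (m g' g)) b" by (simp only: g_def assoc)
    finally show ?thesis by (simp add: g' ae ab)
  qed
  ultimately show "\<exists>y. m f y = y \<and> m y f = y \<and> m x y = f \<and> m y x = f" by blast
qed

text \<open>As a group, $eSe$ is a subgroup of $S$ containing $G$, so maximality applies.\<close>

lemma maximal_subgroup_carrier:
  assumes "semigroup m" "maximal_subgroup m G" "local_group m \<one>\<^bsub>G\<^esub>"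
  shows "carrier G = {x. m \<one>\<^bsub>G\<^esub> x = x \<and> m x \<one>\<^bsub>G\<^esub> = x}"
proof -
  interpret semigroup m by fact
  interpret G: group G using assms(2) by (simp add: maximal_subgroup_def subgroup_of_semigroup_def)
  have m [simp]: "mult G = m"
    using assms(2) by (simp add: maximal_subgroup_def subgroup_of_semigroup_def)
  define K where "K = \<lparr>carrier = {x. m \<one>\<^bsub>G\<^esub> x = x \<and> m x \<one>\<^bsub>G\<^esub> = x}, mult = m, one = \<one>\<^bsub>G\<^esub>\<rparr>"
  have "group K"
  proof (rule groupI)
    show "\<exists>y\<in>carrier K. y \<otimes>\<^bsub>K\<^esub> x = \<one>\<^bsub>K\<^esub>" if "x \<in> carrier K" for x
      using assms(3) that unfolding local_group_def K_def by auto
    show "x \<otimes>\<^bsub>K\<^esub> y \<in> carrier K" if "x \<in> carrier K" "y \<in> carrier K" for x y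
      using that by (simp add: K_def assoc) (simp flip: assoc)
  qed (use assms(3) in \<open>simp_all add: K_def assoc local_group_def\<close>)
  moreover have "carrier G \<subseteq> carrier K"
    using G.l_one G.r_one by (auto simp: K_def)
  moreover have "mult K = m" by (simp add: K_def)
  ultimately have "carrier K = carrier G"
    using assms(2) unfolding maximal_subgroup_def subgroup_of_semigroup_def by blast
  then show ?thesis by (simp add: K_def)
qed

lemma completely_simple_rees_coordinates:
  assumes "completely_simple m" "maximal_subgroup m G"
  shows "rees_coordinates G"
proof -
  have simple: "simple_semigroup m" using assms(1) by (simp add: completely_simple_def)
  then interpret semigroup m by (simp add: simple_semigroup_def)
  interpret G: group G using assms(2) by (simp add: maximal_subgroup_def subgroup_of_semigroup_def)
  have m [simp]: "mult G = m"
    using assms(2) by (simp add: maximal_subgroup_def subgroup_of_semigroup_def)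
  define e where "e = \<one>\<^bsub>G\<^esub>"
  have ee: "m e e = e" using G.r_one[OF G.one_closed] by (simp add: e_def)
  obtain e0 where "primitive_idempotent m e0" using assms(1) by (auto simp: completely_simple_def)
  then have "local_group m e"
    using local_group_primitive[OF simple] local_group_idempotent[OF simple _ ee] by blast
  then have carrier: "carrier G = {x. m e x = x \<and> m x e = x}"
    using maximal_subgroup_carrier[OF semigroup_axioms assms(2)] by (simp add: e_def)
  have local_closed: "m (m e x) e \<in> carrier G" for x
    unfolding carrier using ee by (simp add: assoc) (simp flip: assoc)
  have "m (m x (inv\<^bsub>G\<^esub> (m (m e x) e))) x = x" for x
  proof -
    obtain s t where st: "m (m s e) t = x" using simple_semigroup_divides[OF simple] by blast
    \<comment> \<open>For \<open>x = s e t\<close> the core is \<open>p q\<close> with \<open>p = e s e\<close> and \<open>q = e t e\<close>, and \<open>x (p q)\<inverse> x\<close> contains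
      \<open>q (p q)\<inverse> p = e\<close>.\<close>
    define p q where "p = m (m e s) e" and "q = m (m e t) e"
    have p: "p \<in> carrier G" and q: "q \<in> carrier G" using local_closed by (simp_all add: p_def q_def)
    have "m (m e x) e = m (m e (m (m s (m e e)) t)) e" by (simp only: ee st)
    then have pq: "m (m e x) e = m p q" by (simp only: p_def q_def assoc)
    define y where "y = inv\<^bsub>G\<^esub> (m p q)"
    have "y \<in> carrier G" using G.inv_closed[OF G.m_closed[OF p q]] by (simp add: y_def)
    then have ey: "m e (m y e) = y" by (simp add: carrier)
    have "y = m (inv\<^bsub>G\<^esub> q) (inv\<^bsub>G\<^esub> p)" using G.inv_mult_group[OF p q] by (simp add: y_def)
    then have "m q (m y p) = m (m q (inv\<^bsub>G\<^esub> q)) (m (inv\<^bsub>G\<^esub> p) p)" by (simp only: assoc)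
    also have "\<dots> = e" using G.r_inv[OF q] G.l_inv[OF p] ee by (simp add: e_def)
    finally have qyp: "m q (m y p) = e" .
    have "m (m x y) x = m (m (m (m s e) t) (m e (m y e))) (m (m s e) t)" by (simp only: st ey)
    also have "\<dots> = m (m (m s (m e e)) t) (m e (m y (m e (m (m s (m e e)) t))))" by (simp only: ee assoc)
    also have "\<dots> = m s (m e (m (m q (m y p)) (m e t)))" by (simp only: p_def q_def assoc)
    also have "\<dots> = m (m s (m e (m e e))) t" by (simp only: qyp assoc)
    finally show ?thesis by (simp add: ee st pq y_def)
  qed
  then show ?thesis
    using local_closed by unfold_locales (simp_all add: assoc flip: e_def)
qed

theorem proposition5p11:
  fixes m :: "'a \<Rightarrow> 'a \<Rightarrow> 'a" and G :: "'a monoid"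
  assumes "completely_simple m"
    and "maximal_subgroup m G"
  shows "(nilpotent_alg (semigroup_alg m) \<longleftrightarrow> nilpotent_alg (group_alg G)) \<and>
    (solvable_alg (semigroup_alg m) \<longleftrightarrow> solvable_alg (group_alg G))"
proof -
  interpret rees_coordinates G using completely_simple_rees_coordinates[OF assms] .
  have "mult G = m" using assms(2) by (simp add: maximal_subgroup_def subgroup_of_semigroup_def)
  then show ?thesis using nilpotent_iff solvable_iff by simp
qed

end
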